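(* Let $K$ be a fully symmetric finitely ramified self-similar set with approximating graphs $G_n$ having vertex sets $V_n$. Then the asymptotic complexity constant $$\lim_{n\to\infty}\frac{\log\tau(G_n)}{|V_n|}$$ exists, where $\tau(G_n)$ is the number of spanning trees of $G_n$.
   Context: A fully symmetric finitely ramified self-similar set: $K$ is a compact connected metric space with injective contractions $f_1,\dots,f_m$ (of a complete metric space) such that $K=\bigcup_i f_i(K)$ and (1) there is a finite set $F_0\subset K$ with $f_j(K)\cap f_k(K)=f_j(F_0)\cap f_k(F_0)$ for $j\ne k$; (2) if $v_0\in F_0\cap f_j(K)$ then $v_0$ is the fixed point of $f_j$; (3) there is a group of isometries of $K$ acting doubly transitively on $F_0$ such that for every $j$ and every $g$ in the group there is $k$ with $g^{-1}\circ f_j\circ g=f_k$. Approximating graphs: $V_0=F_0$, $G_0$ is the complete graph on $V_0$, $V_n=\bigcup_{|\omega|=n}f_\omega(V_0)$ with $f_\omega=f_{\omega_1}\circ\dots\circ f_{\omega_n}$, and the edge multiset of $G_n$ is the union over words $\omega$ of length $n$ of the images under $f_\omega$ of the edges of $G_0$; the graphs are assumed connected and loopless. *)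

theory Defs
  imports "HOL-Analysis.Analysis" "HOL-Algebra.Bij"
begin

section \<open>Finite undirected multigraphs and spanning trees\<close>

text \<open>
  Edges are labels, and a label is mapped to its set of endpoints: two vertices, or one
  for a loop. The edge multiset is the image of the set of labels under \<open>ends\<close>, so
  parallel edges are distinct labels with the same endpoints.
\<close>

record ('v, 'e) multigraph =
  verts :: "'v set"
  edges :: "'e set"
  ends :: "'e \<Rightarrow> 'v set"

definition edge_mset :: "('v, 'e) multigraph \<Rightarrow> 'v set multiset" where
  "edge_mset G = image_mset (ends G) (mset_set (edges G))"

definition adjacency :: "('v, 'e) multigraph \<Rightarrow> ('v \<times> 'v) set" where
  "adjacency G = {(u, v). \<exists>e\<in>edges G. ends G e = {u, v}}"

text \<open>The null graph does not count as connected.\<close>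

definition connected_multigraph :: "('v, 'e) multigraph \<Rightarrow> bool" where
  "connected_multigraph G \<longleftrightarrow>
     verts G \<noteq> {} \<and> (\<forall>u\<in>verts G. \<forall>v\<in>verts G. (u, v) \<in> (adjacency G)\<^sup>*)"

definition loopless :: "('v, 'e) multigraph \<Rightarrow> bool" where
  "loopless G \<longleftrightarrow> (\<forall>e\<in>edges G. card (ends G e) = 2)"

text \<open>
  A cycle visits distinct vertices \<open>vs\<close> along distinct edges \<open>es\<close>. Length 1 is a loop and
  length 2 a pair of parallel edges.
\<close>

definition is_cycle :: "('v, 'e) multigraph \<Rightarrow> 'v list \<Rightarrow> 'e list \<Rightarrow> bool" where
  "is_cycle G vs es \<longleftrightarrow>
     es \<noteq> [] \<and> length vs = length es \<and> distinct vs \<and> distinct es \<and>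
     set vs \<subseteq> verts G \<and> set es \<subseteq> edges G \<and>
     (\<forall>i<length es. ends G (es ! i) = {vs ! i, vs ! (Suc i mod length es)})"

definition is_tree :: "('v, 'e) multigraph \<Rightarrow> bool" where
  "is_tree G \<longleftrightarrow> connected_multigraph G \<and> (\<nexists>vs es. is_cycle G vs es)"

text \<open>A spanning tree is identified with its set of edges.\<close>

definition spanning_trees :: "('v, 'e) multigraph \<Rightarrow> 'e set set" where
  "spanning_trees G = {T. T \<subseteq> edges G \<and> is_tree (G\<lparr>edges := T\<rparr>)}"

definition num_spanning_trees :: "('v, 'e) multigraph \<Rightarrow> nat" where
  "num_spanning_trees G = card (spanning_trees G)"

section \<open>Fully symmetric finitely ramified self-similar sets\<close>

definition doubly_transitive_on :: "('a \<Rightarrow> 'a) set \<Rightarrow> 'a set \<Rightarrow> bool" where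
  "doubly_transitive_on \<Gamma> S \<longleftrightarrow>
     (\<forall>g\<in>\<Gamma>. g ` S = S) \<and>
     (\<forall>a\<in>S. \<forall>b\<in>S. \<forall>c\<in>S. \<forall>d\<in>S. a \<noteq> b \<longrightarrow> c \<noteq> d \<longrightarrow> (\<exists>g\<in>\<Gamma>. g a = c \<and> g b = d))"

text \<open>
  The contractions act on the whole complete metric space, which is the type \<open>'a\<close>;
  the isometries in \<open>symmetry\<close> are defined on \<open>K\<close> only.
\<close>

locale fully_symmetric_self_similar_set =
  fixes K :: "'a::complete_space set"
    and m :: nat
    and f :: "nat \<Rightarrow> 'a \<Rightarrow> 'a"
    and F0 :: "'a set"
  assumes compact_K: "compact K"
    and connected_K: "connected K"
    and inj_f: "\<And>j. j \<in> {1..m} \<Longrightarrow> inj (f j)"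
    and contraction_f: "\<And>j. j \<in> {1..m} \<Longrightarrow> \<exists>c<1. c-lipschitz_on UNIV (f j)"
    and self_similar: "K = (\<Union>j\<in>{1..m}. f j ` K)"
    and finite_F0: "finite F0"
    and F0_subset: "F0 \<subseteq> K"
    and finitely_ramified:
      "\<And>j k. j \<in> {1..m} \<Longrightarrow> k \<in> {1..m} \<Longrightarrow> j \<noteq> k \<Longrightarrow>
         f j ` K \<inter> f k ` K = f j ` F0 \<inter> f k ` F0"
    and F0_fixed: "\<And>j v. j \<in> {1..m} \<Longrightarrow> v \<in> F0 \<inter> f j ` K \<Longrightarrow> f j v = v"
    and symmetry:
      "\<exists>\<Gamma>. subgroup \<Gamma> (BijGroup K) \<and>
          (\<forall>g\<in>\<Gamma>. \<forall>x\<in>K. \<forall>y\<in>K. dist (g x) (g y) = dist x y) \<and>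
          doubly_transitive_on \<Gamma> F0 \<and>
          (\<forall>j\<in>{1..m}. \<forall>g\<in>\<Gamma>. \<exists>k\<in>{1..m}. \<forall>x\<in>K. inv_into K g (f j (g x)) = f k x)"

section \<open>Approximating graphs\<close>

definition words :: "nat \<Rightarrow> nat \<Rightarrow> nat list set" where
  "words m n = {w. set w \<subseteq> {1..m} \<and> length w = n}"

text \<open>\<open>foldr f [w1, ..., wn]\<close> is the composition of \<open>f w1, ..., f wn\<close>, with \<open>f wn\<close> applied first.\<close>

definition complete_graph_edges :: "'a set \<Rightarrow> 'a set set" where
  "complete_graph_edges S = {e. e \<subseteq> S \<and> card e = 2}"

definition approx_graph ::
    "nat \<Rightarrow> (nat \<Rightarrow> 'a \<Rightarrow> 'a) \<Rightarrow> 'a set \<Rightarrow> nat \<Rightarrow> ('a, nat list \<times> 'a set) multigraph" where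
  "approx_graph m f F0 n =
     \<lparr>verts = (\<Union>w\<in>words m n. foldr f w ` F0),
      edges = words m n \<times> complete_graph_edges F0,
      ends = (\<lambda>(w, e). foldr f w ` e)\<rparr>"

lemma edge_mset_approx_graph:
  assumes "finite F0"
  shows "edge_mset (approx_graph m f F0 n) =
    (\<Sum>w\<in>words m n. image_mset (\<lambda>e. foldr f w ` e) (mset_set (complete_graph_edges F0)))"
proof -
  have fE: "finite (complete_graph_edges F0)"
    using assms by (auto simp: complete_graph_edges_def intro: finite_subset[of _ "Pow F0"])
  have fW: "finite (words m n)"
    unfolding words_def by (rule finite_lists_length_eq) simp
  have "image_mset (\<lambda>(w, e). foldr f w ` e) (mset_set (W \<times> complete_graph_edges F0)) =
    (\<Sum>w\<in>W. image_mset (\<lambda>e. foldr f w ` e) (mset_set (complete_graph_edges F0)))"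
    if "finite W" for W
    using that
  proof induction
    case (insert w W)
    have eq: "insert w W \<times> complete_graph_edges F0 =
        Pair w ` complete_graph_edges F0 \<union> W \<times> complete_graph_edges F0"
      by auto
    have "mset_set (insert w W \<times> complete_graph_edges F0) =
        image_mset (Pair w) (mset_set (complete_graph_edges F0)) +
        mset_set (W \<times> complete_graph_edges F0)"
      unfolding eq using insert.hyps fE
      by (subst mset_set_Union) (auto simp: image_mset_mset_set inj_on_def)
    then show ?case
      using insert by (simp add: multiset.map_comp o_def)
  qed simp
  from this[OF fW] show ?thesis
    by (simp add: edge_mset_def approx_graph_def)
qed

end

theory Submission
  imports Defs
begin

text \<open>
  \<open>G\<^bsub>n+1\<^esub>\<close> consists of \<open>m\<close> copies of \<open>G\<^sub>n\<close>
  glued along images of \<open>F\<^sub>0\<close>, so a spanning tree of \<open>G\<^bsub>n+1\<^esub>\<close> and a union of \<open>m\<close> spanning trees,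
  one in each copy, can be chosen to contain one another up to at most \<open>m |F\<^sub>0|\<close> edges.
  Hence \<open>\<bar>log \<tau>(G\<^bsub>n+1\<^esub>) - m log \<tau>(G\<^sub>n)\<bar> \<le> m |F\<^sub>0| log (|E\<^bsub>n+1\<^esub>| + 1) = O(n)\<close>, so
  \<open>log \<tau>(G\<^sub>n) / m\<^sup>n\<close> is a Cauchy sequence; so is \<open>|V\<^sub>n| / m\<^sup>n\<close>, and its limit is positive because the
  number of vertices outside \<open>F\<^sub>0\<close> grows at least by the factor \<open>m\<close>. If \<open>|F\<^sub>0| \<le> 1\<close>, there are no
  edges and \<open>\<tau>(G\<^sub>n) = 1\<close>.
\<close>

section \<open>Independent edge sets\<close>

text \<open>The adjacency relation of an edge set under an endpoint map, kept apart from the graph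
  record so that edge sets can vary freely. Its reflexive transitive closure is an equivalence on
  the whole type, whose classes are the connected components.\<close>

definition link :: "('e \<Rightarrow> 'v set) \<Rightarrow> 'e set \<Rightarrow> ('v \<times> 'v) set" where
  "link d F = {(u, v). \<exists>e\<in>F. d e = {u, v}}"

text \<open>Independence in the cycle matroid, phrased through connectivity rather than cycles:
  every edge is a bridge. This form is easier to use in inductions over edge sets.\<close>

definition indep :: "('e \<Rightarrow> 'v set) \<Rightarrow> 'e set \<Rightarrow> bool" where
  "indep d F \<longleftrightarrow> (\<forall>e\<in>F. \<forall>u v. d e = {u, v} \<longrightarrow> (u, v) \<notin> (link d (F - {e}))\<^sup>*)"

lemma adjacency_edges_update: "adjacency (G\<lparr>edges := F\<rparr>) = link (ends G) F"
  by (simp add: adjacency_def link_def)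

lemma link_mono: "F \<subseteq> F' \<Longrightarrow> link d F \<subseteq> link d F'"
  by (auto simp: link_def)

lemma sym_link: "sym (link d F)"
  by (auto simp: sym_def link_def insert_commute)

lemma sym_rtrancl_link: "(x, y) \<in> (link d F)\<^sup>* \<Longrightarrow> (y, x) \<in> (link d F)\<^sup>*"
  using sym_rtrancl[OF sym_link] by (rule symD)

lemma equiv_rtrancl_link: "equiv UNIV ((link d F)\<^sup>*)"
  by (simp add: equiv_def refl_rtrancl sym_rtrancl[OF sym_link] trans_rtrancl)

text \<open>A walk can be shortened until it crosses the new edge at most once, in one of its two
  directions.\<close>

lemma rtrancl_link_insert_iff:
  assumes "d e = {u, v}"
  shows "(x, y) \<in> (link d (insert e F))\<^sup>* \<longleftrightarrow>
    (x, y) \<in> (link d F)\<^sup>* \<or>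
    (x, u) \<in> (link d F)\<^sup>* \<and> (v, y) \<in> (link d F)\<^sup>* \<or>
    (x, v) \<in> (link d F)\<^sup>* \<and> (u, y) \<in> (link d F)\<^sup>*"
proof -
  have "link d (insert e F) = insert (u, v) (insert (v, u) (link d F))"
    using assms by (auto simp: link_def doubleton_eq_iff)
  then show ?thesis
    by (auto simp: rtrancl_insert intro: rtrancl_trans)
qed

text \<open>If an old edge \<open>e'\<close> stopped being a bridge, the connection between its
  endpoints would have to cross \<open>e\<close>. The rest of that connection together with
  \<open>e'\<close> would then join \<open>u\<close> and \<open>v\<close> within
  \<open>F\<close>.\<close>

lemma indep_insert:
  assumes "indep d F" and e: "d e = {u, v}" and "(u, v) \<notin> (link d F)\<^sup>*"
  shows "indep d (insert e F)"
  unfolding indep_def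
proof (intro ballI allI impI)
  fix e' a b
  assume e': "e' \<in> insert e F" and ab: "d e' = {a, b}"
  show "(a, b) \<notin> (link d (insert e F - {e'}))\<^sup>*"
  proof (cases "e' = e")
    case True
    then have "(u, v) \<notin> (link d (insert e F - {e'}))\<^sup>*"
      using assms(3) rtrancl_mono[OF link_mono[of "insert e F - {e'}" F d]] by blast
    then show ?thesis
      using True e ab by (metis doubleton_eq_iff sym_rtrancl_link)
  next
    case False
    then have "e' \<in> F" using e' by auto
    then have nab: "(a, b) \<notin> (link d (F - {e'}))\<^sup>*"
      using assms(1) ab by (auto simp: indep_def)
    have F: "F = insert e' (F - {e'})" using \<open>e' \<in> F\<close> by auto
    have eq: "insert e F - {e'} = insert e (F - {e'})" using False by auto
    have "(u, v) \<notin> (link d (insert e' (F - {e'})))\<^sup>*"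
      using assms(3) F by simp
    then show ?thesis
      using nab unfolding eq rtrancl_link_insert_iff[of d e u v, OF e] rtrancl_link_insert_iff[of d e' a b, OF ab]
      by (meson sym_rtrancl_link)
  qed
qed

text \<open>Greedy choice: the edges of \<open>X\<close> are considered one by one, and an edge is
  skipped exactly when its endpoints are already connected.\<close>

lemma indep_extend:
  assumes "finite X" and "indep d F" and "\<And>e. e \<in> X \<Longrightarrow> \<exists>u v. d e = {u, v}"
  shows "\<exists>T. F \<subseteq> T \<and> T \<subseteq> F \<union> X \<and> indep d T \<and> link d (F \<union> X) \<subseteq> (link d T)\<^sup>*"
  using assms(1,3)
proof induction
  case empty
  then show ?case using assms(2) by auto
next
  case (insert e X)
  then obtain T where T: "F \<subseteq> T" "T \<subseteq> F \<union> X" "indep d T" "link d (F \<union> X) \<subseteq> (link d T)\<^sup>*"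
    by auto
  obtain u v where e: "d e = {u, v}" using insert.prems by blast
  have l: "link d (F \<union> insert e X) = insert (u, v) (insert (v, u) (link d (F \<union> X)))"
    using e by (auto simp: link_def doubleton_eq_iff)
  show ?case
  proof (cases "(u, v) \<in> (link d T)\<^sup>*")
    case True
    then show ?thesis
      using T sym_rtrancl_link[OF True] unfolding l by (intro exI[of _ T]) auto
  next
    case False
    have "(link d T)\<^sup>* \<subseteq> (link d (insert e T))\<^sup>*"
      by (intro rtrancl_mono link_mono) auto
    moreover have "(u, v) \<in> (link d (insert e T))\<^sup>*" "(v, u) \<in> (link d (insert e T))\<^sup>*"
      using e by (auto simp: link_def insert_commute)
    ultimately show ?thesis
      using T indep_insert[OF T(3) e False] unfolding l by (intro exI[of _ "insert e T"]) auto
  qed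
qed

text \<open>Each edge of a forest merges two distinct components, so inserting it lowers the number
  of components by exactly one, starting from \<open>card V\<close> singletons.\<close>

lemma card_components_indep:
  assumes "finite V" and "finite F" and "indep d F"
    and "\<And>e. e \<in> F \<Longrightarrow> \<exists>u\<in>V. \<exists>v\<in>V. d e = {u, v}"
  shows "card (V // (link d F)\<^sup>*) + card F = card V"
  using assms(2-)
proof induction
  case empty
  have "link d {} = {}" by (simp add: link_def)
  then have "V // (link d {})\<^sup>* = (\<lambda>x. {x}) ` V"
    by (auto simp: quotient_def)
  then show ?case by (simp add: card_image)
next
  case (insert e F)
  let ?R = "(link d F)\<^sup>*" and ?R' = "(link d (insert e F))\<^sup>*"
  obtain u v where uv: "u \<in> V" "v \<in> V" and e: "d e = {u, v}"
    using insert.prems by blast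
  have ind: "indep d F"
    unfolding indep_def
  proof (intro ballI allI impI)
    fix e' a b assume "e' \<in> F" "d e' = {a, b}"
    then have "(a, b) \<notin> (link d (insert e F - {e'}))\<^sup>*"
      using insert.prems(1) by (auto simp: indep_def)
    then show "(a, b) \<notin> (link d (F - {e'}))\<^sup>*"
      using rtrancl_mono[OF link_mono[of "F - {e'}" "insert e F - {e'}" d]] by blast
  qed
  have IH: "card (V // ?R) + card F = card V"
    using insert.IH[OF ind] insert.prems(2) by auto
  have nuv: "(u, v) \<notin> ?R"
    using insert.prems(1) insert.hyps e by (force simp: indep_def)
  let ?U = "?R `` {u}" and ?W = "?R `` {v}"
  note eq = eq_equiv_class_iff[OF equiv_rtrancl_link UNIV_I UNIV_I, of d F]
  have ne: "?U \<noteq> ?W" using nuv eq by simp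
  \<comment> \<open>Inserting \<open>e\<close> unites the classes of its two endpoints and leaves
    every other class alone.\<close>
  have cls: "?R' `` {x} = (if (u, x) \<in> ?R \<or> (v, x) \<in> ?R then ?U \<union> ?W else ?R `` {x})" for x
    unfolding set_eq_iff Image_singleton_iff rtrancl_link_insert_iff[of d e u v, OF e]
    by (auto dest: sym_rtrancl_link intro: rtrancl_trans)
  have "V // ?R' = insert (?U \<union> ?W) (V // ?R - {?U, ?W})"
  proof
    show "V // ?R' \<subseteq> insert (?U \<union> ?W) (V // ?R - {?U, ?W})"
    proof
      fix C assume "C \<in> V // ?R'"
      then obtain x where x: "x \<in> V" "C = ?R' `` {x}" by (auto simp: quotient_def)
      show "C \<in> insert (?U \<union> ?W) (V // ?R - {?U, ?W})"
      proof (cases "(u, x) \<in> ?R \<or> (v, x) \<in> ?R")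
        case True
        then show ?thesis using x(2) unfolding cls by simp
      next
        case False
        then have "C = ?R `` {x}" using x(2) unfolding cls by simp
        moreover have "?R `` {x} \<noteq> ?U" "?R `` {x} \<noteq> ?W" using False eq by metis+
        ultimately show ?thesis using x(1) by (simp add: quotientI)
      qed
    qed
    show "insert (?U \<union> ?W) (V // ?R - {?U, ?W}) \<subseteq> V // ?R'"
    proof
      fix C assume "C \<in> insert (?U \<union> ?W) (V // ?R - {?U, ?W})"
      then consider "C = ?U \<union> ?W" | x where "x \<in> V" "C = ?R `` {x}" "C \<noteq> ?U" "C \<noteq> ?W"
        by (auto simp: quotient_def)
      then show "C \<in> V // ?R'"
      proof cases
        case 1
        then have "C = ?R' `` {u}" unfolding cls by simp
        then show ?thesis using uv by (auto intro: quotientI)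
      next
        case 2
        then have "C = ?R' `` {x}" unfolding cls using eq by metis
        then show ?thesis using 2 by (auto intro: quotientI)
      qed
    qed
  qed
  \<comment> \<open>The merged class is really new: an old class containing both \<open>u\<close>
    and \<open>v\<close> would connect them without \<open>e\<close>.\<close>
  moreover have "?U \<union> ?W \<notin> V // ?R - {?U, ?W}"
  proof
    assume "?U \<union> ?W \<in> V // ?R - {?U, ?W}"
    then obtain x where x: "?U \<union> ?W = ?R `` {x}" by (auto simp: quotient_def)
    then have "(x, u) \<in> ?R" "(x, v) \<in> ?R" by blast+
    then show False using nuv by (meson rtrancl_trans sym_rtrancl_link)
  qed
  moreover have fin: "finite (V // ?R)" using assms(1) by (simp add: quotient_def)
  moreover have sub: "{?U, ?W} \<subseteq> V // ?R" using uv by (auto intro: quotientI)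
  moreover have "2 \<le> card (V // ?R)" using card_mono[OF fin sub] ne by simp
  ultimately have "card (V // ?R') = Suc (card (V // ?R) - 2)"
    using ne by (simp add: card_Diff_subset)
  with \<open>2 \<le> card (V // ?R)\<close> show ?case
    using IH insert.hyps by simp
qed

section \<open>Spanning trees\<close>

text \<open>Distinct vertices are obtained while prepending edges: if the new first vertex already
  occurs on the path, everything before that occurrence is dropped.\<close>

lemma rtrancl_link_path:
  assumes "(x, y) \<in> (link d F)\<^sup>*"
  shows "\<exists>vs es. distinct vs \<and> length vs = Suc (length es) \<and> set es \<subseteq> F \<and>
    vs ! 0 = x \<and> vs ! length es = y \<and> (\<forall>i<length es. d (es ! i) = {vs ! i, vs ! Suc i})"
  using assms
proof (induction rule: converse_rtrancl_induct)
  case base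
  show ?case by (intro exI[of _ "[y]"] exI[of _ "[]"]) simp
next
  case (step x z)
  then obtain vs es where p: "distinct vs" "length vs = Suc (length es)" "set es \<subseteq> F"
    "vs ! 0 = z" "vs ! length es = y" "\<And>i. i < length es \<Longrightarrow> d (es ! i) = {vs ! i, vs ! Suc i}"
    by blast
  obtain e where e: "e \<in> F" "d e = {x, z}" using step by (auto simp: link_def)
  show ?case
  proof (cases "x \<in> set vs")
    case True
    then obtain k where k: "k < length vs" "vs ! k = x" by (auto simp: in_set_conv_nth)
    then show ?thesis
      using p by (intro exI[of _ "drop k vs"] exI[of _ "drop k es"]) (auto dest: in_set_dropD)
  next
    case False
    then show ?thesis
      using p e by (intro exI[of _ "x # vs"] exI[of _ "e # es"]) (auto simp: nth_Cons split: nat.split)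
  qed
qed

locale finite_multigraph =
  fixes G :: "('v, 'e) multigraph"
  assumes finite_verts: "finite (verts G)"
    and finite_edges: "finite (edges G)"
    and ends_verts: "\<And>e. e \<in> edges G \<Longrightarrow> \<exists>u\<in>verts G. \<exists>v\<in>verts G. ends G e = {u, v}"
begin

text \<open>An edge that is not a bridge closes a path between its endpoints to a cycle. Conversely,
  a cycle without its first edge still connects the endpoints of that edge.\<close>

lemma acyclic_iff_indep:
  assumes F: "F \<subseteq> edges G"
  shows "(\<nexists>vs es. is_cycle (G\<lparr>edges := F\<rparr>) vs es) \<longleftrightarrow> indep (ends G) F"
proof
  assume acyc: "\<nexists>vs es. is_cycle (G\<lparr>edges := F\<rparr>) vs es"
  show "indep (ends G) F"
    unfolding indep_def
  proof (intro ballI allI impI notI)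
    fix e u v
    assume e: "e \<in> F" "ends G e = {u, v}" and r: "(u, v) \<in> (link (ends G) (F - {e}))\<^sup>*"
    obtain vs es where p: "distinct vs" "length vs = Suc (length es)" "set es \<subseteq> F - {e}"
      "vs ! 0 = u" "vs ! length es = v"
      "\<And>i. i < length es \<Longrightarrow> ends G (es ! i) = {vs ! i, vs ! Suc i}"
      using rtrancl_link_path[OF r] by blast
    \<comment> \<open>A repeated edge would give two different pairs of consecutive vertices the
      same endpoints, which the distinctness of \<open>vs\<close> forbids.\<close>
    have "distinct es"
    proof (rule ccontr)
      assume "\<not> distinct es"
      then obtain i j where ij: "i < length es" "j < length es" "i \<noteq> j" "es ! i = es ! j"
        by (auto simp: distinct_conv_nth)
      then have "{vs ! i, vs ! Suc i} = {vs ! j, vs ! Suc j}"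
        using p(6) by metis
      then show False
        using ij p(1,2) by (auto simp: doubleton_eq_iff nth_eq_iff_index_eq)
    qed
    moreover have "set vs \<subseteq> verts G"
    proof
      fix x assume "x \<in> set vs"
      then obtain i where i: "i < Suc (length es)" "x = vs ! i"
        using p(2) by (auto simp: in_set_conv_nth)
      have "\<exists>e'\<in>edges G. x \<in> ends G e'"
      proof (cases "i = length es")
        case True
        then show ?thesis using e i F p(5) by auto
      next
        case False
        then have "i < length es" using i by simp
        then show ?thesis using i p(3,6) F by (intro bexI[of _ "es ! i"]) (auto dest: nth_mem)
      qed
      then show "x \<in> verts G" using ends_verts by fastforce
    qed
    moreover have "ends G ((es @ [e]) ! i) = {vs ! i, vs ! (Suc i mod Suc (length es))}"
      if "i < Suc (length es)" for i
      using that p(4,5,6) e(2) by (cases "i = length es") (auto simp: nth_append)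
    ultimately have "is_cycle (G\<lparr>edges := F\<rparr>) vs (es @ [e])"
      using p(1-3) e(1) by (auto simp: is_cycle_def)
    then show False using acyc by blast
  qed
next
  assume ind: "indep (ends G) F"
  show "\<nexists>vs es. is_cycle (G\<lparr>edges := F\<rparr>) vs es"
  proof clarify
    fix vs es assume c: "is_cycle (G\<lparr>edges := F\<rparr>) vs es"
    let ?L = "length es"
    have L: "0 < ?L" using c by (simp add: is_cycle_def)
    have en: "ends G (es ! i) = {vs ! i, vs ! (Suc i mod ?L)}" if "i < ?L" for i
      using c that by (simp add: is_cycle_def)
    \<comment> \<open>The walk leaves the far end of the first edge and goes round the cycle. At
      \<open>i = ?L - 1\<close> the index wraps to 0; writing \<open>1 mod ?L\<close> also covers a
      loop, where \<open>?L = 1\<close>.\<close>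
    have "(vs ! (1 mod ?L), vs ! (Suc i mod ?L)) \<in> (link (ends G) (F - {es ! 0}))\<^sup>*" if "i < ?L" for i
      using that
    proof (induction i)
      case (Suc i)
      then have "es ! Suc i \<in> F - {es ! 0}"
        using c L by (auto simp: is_cycle_def nth_eq_iff_index_eq dest: nth_mem)
      then have "(vs ! (Suc i mod ?L), vs ! (Suc (Suc i) mod ?L)) \<in> link (ends G) (F - {es ! 0})"
        using en[OF Suc.prems] Suc.prems by (auto simp: link_def)
      then show ?case using Suc by (meson Suc_lessD rtrancl.rtrancl_into_rtrancl)
    qed simp
    from this[of "?L - 1"] have "(vs ! 0, vs ! (1 mod ?L)) \<in> (link (ends G) (F - {es ! 0}))\<^sup>*"
      using L by (simp add: sym_rtrancl_link)
    moreover have "es ! 0 \<in> F" using c L by (auto simp: is_cycle_def dest: nth_mem)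
    ultimately show False using ind en[OF L] by (auto simp: indep_def)
  qed
qed

lemma spanning_trees_iff:
  "T \<in> spanning_trees G \<longleftrightarrow> T \<subseteq> edges G \<and> verts G \<noteq> {} \<and>
    verts G \<times> verts G \<subseteq> (link (ends G) T)\<^sup>* \<and> indep (ends G) T"
  using acyclic_iff_indep[of T]
  by (auto simp: spanning_trees_def is_tree_def connected_multigraph_def adjacency_edges_update)

lemma finite_spanning_trees: "finite (spanning_trees G)"
  using finite_edges by (auto simp: spanning_trees_def intro: finite_subset[of _ "Pow (edges G)"])

text \<open>All vertices lie in one class, so the component count of the forest \<open>T\<close> is
  1.\<close>

lemma card_spanning_tree:
  assumes "T \<in> spanning_trees G"
  shows "card (verts G) = Suc (card T)"
proof -
  have T: "T \<subseteq> edges G" "verts G \<noteq> {}" "verts G \<times> verts G \<subseteq> (link (ends G) T)\<^sup>*" "indep (ends G) T"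
    using assms by (auto simp: spanning_trees_iff)
  obtain x where x: "x \<in> verts G" using T by blast
  have "(link (ends G) T)\<^sup>* `` {y} = (link (ends G) T)\<^sup>* `` {x}" if "y \<in> verts G" for y
  proof (rule equiv_class_eq[OF equiv_rtrancl_link])
    show "(y, x) \<in> (link (ends G) T)\<^sup>*" using T(3) x that by auto
  qed
  then have "verts G // (link (ends G) T)\<^sup>* = {(link (ends G) T)\<^sup>* `` {x}}"
    using x unfolding quotient_def by blast
  then show ?thesis
    using card_components_indep[of "verts G" T "ends G"] finite_verts finite_edges T ends_verts
    by (simp add: finite_subset subset_iff)
qed

text \<open>Used in two ways: to enlarge a forest to a spanning tree, and, with \<open>F\<close>
  empty, to thin out a connecting edge set \<open>S\<close>.\<close>

lemma indep_extends_to_spanning_tree: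
  assumes "F \<subseteq> S" and "S \<subseteq> edges G" and "indep (ends G) F" and "verts G \<noteq> {}"
    and conn: "verts G \<times> verts G \<subseteq> (link (ends G) S)\<^sup>*"
  shows "\<exists>T\<in>spanning_trees G. F \<subseteq> T \<and> T \<subseteq> S"
proof -
  have "F \<union> S = S" using assms(1) by auto
  obtain T where T: "F \<subseteq> T" "T \<subseteq> S" "indep (ends G) T" "link (ends G) S \<subseteq> (link (ends G) T)\<^sup>*"
    using indep_extend[of S "ends G" F] assms finite_edges ends_verts
    by (metis (no_types, lifting) \<open>F \<union> S = S\<close> finite_subset subset_iff)
  have "(link (ends G) S)\<^sup>* \<subseteq> (link (ends G) T)\<^sup>*"
    using T(4) rtrancl_subset_rtrancl by blast
  then have "T \<in> spanning_trees G"
    using T assms unfolding spanning_trees_iff by blast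
  then show ?thesis using T by blast
qed

end

section \<open>Counting sets up to few elements\<close>

text \<open>With \<open>N = card E\<close>, each binomial coefficient \<open>N choose k\<close> is
  at most \<open>(c choose k) * N ^ k\<close>, and these terms sum to
  \<open>(N + 1) ^ c\<close>.\<close>

lemma card_small_subsets_le:
  assumes "finite E"
  shows "card {R. R \<subseteq> E \<and> card R \<le> c} \<le> (card E + 1) ^ c"
proof -
  have "{R. R \<subseteq> E \<and> card R \<le> c} = (\<Union>k\<in>{..c}. {R. R \<subseteq> E \<and> card R = k})"
    by auto
  also have "card \<dots> \<le> (\<Sum>k\<le>c. card {R. R \<subseteq> E \<and> card R = k})"
    by (rule card_UN_le) simp
  also have "\<dots> = (\<Sum>k\<le>c. card E choose k)"
    using n_subsets[OF assms] by simp
  also have "\<dots> \<le> (\<Sum>k\<le>c. (c choose k) * card E ^ k)"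
  proof (rule sum_mono)
    fix k assume "k \<in> {..c}"
    then have "1 \<le> c choose k" by (simp add: Suc_le_eq)
    have "card E choose k \<le> card E ^ k"
      by (cases "k \<le> card E") (simp_all add: binomial_le_pow binomial_eq_0)
    also have "\<dots> \<le> (c choose k) * card E ^ k"
      using \<open>1 \<le> c choose k\<close> by simp
    finally show "card E choose k \<le> (c choose k) * card E ^ k" .
  qed
  also have "\<dots> = (card E + 1) ^ c"
    using binomial_ring[of "card E" 1 c] by simp
  finally show ?thesis .
qed

text \<open>A set is recovered from a nearby one and their symmetric difference, which is a subset
  of \<open>E\<close> with at most \<open>c\<close> elements.\<close>

lemma card_le_if_nearby:
  assumes "finite E" and "finite \<B>" and "\<Union>\<A> \<subseteq> E" and "\<Union>\<B> \<subseteq> E"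
    and near: "\<And>A. A \<in> \<A> \<Longrightarrow> \<exists>B\<in>\<B>. card (sym_diff A B) \<le> c"
  shows "card \<A> \<le> card \<B> * (card E + 1) ^ c"
proof -
  let ?R = "{R. R \<subseteq> E \<and> card R \<le> c}"
  have fin: "finite ?R" using assms(1) by (auto intro: finite_subset[of _ "Pow E"])
  have "\<A> \<subseteq> (\<lambda>(B, R). sym_diff B R) ` (\<B> \<times> ?R)"
  proof
    fix A assume A: "A \<in> \<A>"
    then obtain B where B: "B \<in> \<B>" "card (sym_diff A B) \<le> c" using near by blast
    moreover have "A = sym_diff B (sym_diff A B)" by auto
    moreover have "sym_diff A B \<subseteq> E" using A B assms(3,4) by auto
    ultimately show "A \<in> (\<lambda>(B, R). sym_diff B R) ` (\<B> \<times> ?R)"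
      by (intro image_eqI[of _ _ "(B, sym_diff A B)"]) auto
  qed
  then have "card \<A> \<le> card (\<B> \<times> ?R)"
    using assms(2) fin by (intro surj_card_le) auto
  also have "\<dots> \<le> card \<B> * (card E + 1) ^ c"
    using card_small_subsets_le[OF assms(1)] by (simp add: card_cartesian_product)
  finally show ?thesis .
qed

section \<open>Gluing edge sets\<close>

text \<open>The first letter of a word is the outermost map, so prefixing \<open>j\<close> turns an
  edge label of one level into the label of its image in the \<open>j\<close>-th copy on the next
  level.\<close>

definition glue :: "nat \<Rightarrow> (nat \<Rightarrow> (nat list \<times> 'b) set) \<Rightarrow> (nat list \<times> 'b) set" where
  "glue m S = {(j # w, e) | j w e. j \<in> {1..m} \<and> (w, e) \<in> S j}"

text \<open>The part of \<open>T\<close> in the \<open>j\<close>-th copy, carried back to the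
  smaller graph.\<close>

definition piece :: "nat \<Rightarrow> (nat list \<times> 'b) set \<Rightarrow> (nat list \<times> 'b) set" where
  "piece j T = {(w, e). (j # w, e) \<in> T}"

lemma Cons_in_glue [simp]: "(j # w, e) \<in> glue m S \<longleftrightarrow> j \<in> {1..m} \<and> (w, e) \<in> S j"
  by (auto simp: glue_def)

lemma glue_mono: "(\<And>j. j \<in> {1..m} \<Longrightarrow> S j \<subseteq> S' j) \<Longrightarrow> glue m S \<subseteq> glue m S'"
  by (fastforce simp: glue_def)

lemma card_glue:
  assumes "\<And>j. j \<in> {1..m} \<Longrightarrow> finite (S j)"
  shows "card (glue m S) = (\<Sum>j=1..m. card (S j))"
proof -
  have "glue m S = (\<lambda>(j, w, e). (j # w, e)) ` Sigma {1..m} S"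
    by (force simp: glue_def)
  moreover have "inj_on (\<lambda>(j, w, e). (j # w, e)) (Sigma {1..m} S)"
    by (auto simp: inj_on_def)
  ultimately show ?thesis
    using assms by (simp add: card_image)
qed

text \<open>The first letters of the labels tell the components apart. Extensionality of
  \<open>PiE\<close> fixes the values outside the index set, so counting glued families counts the
  families themselves.\<close>

lemma inj_on_glue: "inj_on (glue m) (PiE {1..m} A)"
proof (rule inj_onI)
  fix S S' assume S: "S \<in> PiE {1..m} A" "S' \<in> PiE {1..m} A" and eq: "glue m S = glue m S'"
  show "S = S'"
  proof (rule PiE_ext[OF S])
    fix j assume "j \<in> {1..m}"
    then have "(w, e) \<in> S j \<longleftrightarrow> (w, e) \<in> S' j" for w e
      using eq Cons_in_glue[of j w e m S] Cons_in_glue[of j w e m S'] by simp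
    then show "S j = S' j" by auto
  qed
qed

section \<open>The approximating graphs\<close>

lemma finite_words: "finite (words m n)"
  unfolding words_def by (rule finite_lists_length_eq) simp

lemma card_words: "card (words m n) = m ^ n"
  unfolding words_def by (subst card_lists_length_eq) simp_all

lemma words_0: "words m 0 = {[]}"
  by (auto simp: words_def)

lemma words_Suc: "words m (Suc n) = (\<Union>j\<in>{1..m}. (#) j ` words m n)"
  by (auto simp: words_def length_Suc_conv)

lemma finite_complete_graph_edges: "finite S \<Longrightarrow> finite (complete_graph_edges S)"
  by (auto simp: complete_graph_edges_def intro: finite_subset[of _ "Pow S"])

lemma edges_approx_graph_Suc:
  "edges (approx_graph m f F0 (Suc n)) = glue m (\<lambda>_. edges (approx_graph m f F0 n))"
  by (auto simp: approx_graph_def words_Suc glue_def)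

lemma verts_approx_graph_Suc:
  "verts (approx_graph m f F0 (Suc n)) = (\<Union>j\<in>{1..m}. f j ` verts (approx_graph m f F0 n))"
  by (auto simp: approx_graph_def words_Suc)

lemma ends_approx_graph: "ends (approx_graph m f F0 n) = (\<lambda>(w, e). foldr f w ` e)"
  by (simp add: approx_graph_def)

lemma finite_multigraph_approx_graph:
  assumes "finite F0"
  shows "finite_multigraph (approx_graph m f F0 n)"
proof
  show "finite (verts (approx_graph m f F0 n))" "finite (edges (approx_graph m f F0 n))"
    using assms by (auto simp: approx_graph_def finite_words finite_complete_graph_edges)
  fix x assume "x \<in> edges (approx_graph m f F0 n)"
  then obtain w e where x: "x = (w, e)" "w \<in> words m n" "e \<subseteq> F0" "card e = 2"
    by (auto simp: approx_graph_def complete_graph_edges_def)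
  then obtain a b where "e = {a, b}" by (auto simp: card_2_iff)
  with x show "\<exists>u\<in>verts (approx_graph m f F0 n). \<exists>v\<in>verts (approx_graph m f F0 n).
      ends (approx_graph m f F0 n) x = {u, v}"
    by (intro bexI[of _ "foldr f w a"] bexI[of _ "foldr f w b"]) (auto simp: approx_graph_def)
qed

lemma foldr_Cons_image: "foldr f (j # w) ` e = f j ` foldr f w ` e"
  by (simp add: image_image)

text \<open>Applying \<open>f j\<close> to each vertex of a walk and prefixing \<open>j\<close> to
  the label of each edge gives a walk in \<open>T\<close>.\<close>

lemma rtrancl_link_piece:
  assumes "(u, v) \<in> (link (\<lambda>(w, e). foldr f w ` e) (piece j T))\<^sup>*"
  shows "(f j u, f j v) \<in> (link (\<lambda>(w, e). foldr f w ` e) T)\<^sup>*"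
  using assms
proof induction
  case (step y z)
  then obtain w e where "(j # w, e) \<in> T" "foldr f w ` e = {y, z}"
    by (auto simp: link_def piece_def)
  moreover from this have "foldr f (j # w) ` e = {f j y, f j z}"
    by (simp add: foldr_Cons_image del: foldr.simps)
  ultimately have "(f j y, f j z) \<in> link (\<lambda>(w, e). foldr f w ` e) T"
    by (auto simp: link_def simp del: foldr.simps intro!: bexI[of _ "(j # w, e)"])
  then show ?case using step by (meson rtrancl.rtrancl_into_rtrancl)
qed simp

text \<open>A detour around an edge inside one copy is mapped by \<open>f j\<close> to a detour
  around the corresponding edge of \<open>T\<close>.\<close>

lemma indep_piece:
  assumes "indep (\<lambda>(w, e). foldr f w ` e) T"
  shows "indep (\<lambda>(w, e). foldr f w ` e) (piece j T)"
  unfolding indep_def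
proof (intro ballI allI impI notI)
  fix x u v
  assume x: "x \<in> piece j T" "(\<lambda>(w, e). foldr f w ` e) x = {u, v}"
    and r: "(u, v) \<in> (link (\<lambda>(w, e). foldr f w ` e) (piece j T - {x}))\<^sup>*"
  obtain w e where we: "x = (w, e)" "(j # w, e) \<in> T" "foldr f w ` e = {u, v}"
    using x by (auto simp: piece_def)
  have "piece j T - {x} = piece j (T - {(j # w, e)})"
    using we by (auto simp: piece_def)
  then have "(f j u, f j v) \<in> (link (\<lambda>(w, e). foldr f w ` e) (T - {(j # w, e)}))\<^sup>*"
    using r rtrancl_link_piece by metis
  moreover have "(\<lambda>(w, e). foldr f w ` e) (j # w, e) = {f j u, f j v}"
    using we by (simp add: foldr_Cons_image del: foldr.simps)
  ultimately show False using assms we unfolding indep_def by blast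
qed

section \<open>Comparing the spanning trees of consecutive approximating graphs\<close>

context
  fixes m :: nat and f :: "nat \<Rightarrow> 'a \<Rightarrow> 'a" and F0 :: "'a set"
  assumes finite_F0: "finite F0"
    and conn: "\<And>n. connected_multigraph (approx_graph m f F0 n)"
begin

private abbreviation (input) "G \<equiv> approx_graph m f F0"

interpretation finite_multigraph "G n" for n
  by (rule finite_multigraph_approx_graph[OF finite_F0])

lemma verts_nonempty: "verts (G n) \<noteq> {}"
  using conn[of n] by (simp add: connected_multigraph_def)

lemma approx_graph_connected: "verts (G n) \<times> verts (G n) \<subseteq> (link (ends (G n)) (edges (G n)))\<^sup>*"
proof -
  have "adjacency (G n) = link (ends (G n)) (edges (G n))"
    by (simp only: adjacency_def link_def)
  then show ?thesis
    using conn[of n] unfolding connected_multigraph_def by auto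
qed

text \<open>The empty forest extends to a spanning tree. Positivity is what makes the logarithms
  meaningful.\<close>

lemma num_spanning_trees_pos: "0 < num_spanning_trees (G n)"
proof -
  have "\<exists>T\<in>spanning_trees (G n). {} \<subseteq> T \<and> T \<subseteq> edges (G n)"
    by (rule indep_extends_to_spanning_tree[OF _ _ _ verts_nonempty approx_graph_connected])
      (simp_all add: indep_def)
  then show ?thesis
    using finite_spanning_trees by (auto simp: num_spanning_trees_def card_gt_0_iff)
qed

private abbreviation (input) glued_trees :: "nat \<Rightarrow> (nat list \<times> 'a set) set set" where
  "glued_trees n \<equiv> glue m ` PiE {1..m} (\<lambda>_. spanning_trees (G n))"

lemma card_glued_trees: "card (glued_trees n) = num_spanning_trees (G n) ^ m"
  by (subst card_image[OF inj_on_glue]) (simp add: card_PiE num_spanning_trees_def)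

lemma glued_trees_edges:
  assumes "S \<in> glued_trees n"
  shows "S \<subseteq> edges (G (Suc n))"
proof -
  have "glue m S' \<subseteq> edges (G (Suc n))" if "S' \<in> PiE {1..m} (\<lambda>_. spanning_trees (G n))" for S'
    unfolding edges_approx_graph_Suc
    using that by (intro glue_mono) (auto simp: spanning_trees_def PiE_def Pi_def)
  then show ?thesis using assms by auto
qed

lemma card_glued_tree:
  assumes "S \<in> glued_trees n"
  shows "card S = m * (card (verts (G n)) - 1)"
proof -
  obtain S' where S': "S = glue m S'" "S' \<in> PiE {1..m} (\<lambda>_. spanning_trees (G n))"
    using assms by auto
  then have t: "S' j \<in> spanning_trees (G n)" if "j \<in> {1..m}" for j using that by auto
  then have "finite (S' j)" if "j \<in> {1..m}" for j
    using that finite_edges[of n] by (auto simp: spanning_trees_def intro: finite_subset)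
  moreover have "card (S' j) = card (verts (G n)) - 1" if "j \<in> {1..m}" for j
    using card_spanning_tree[OF t[OF that]] by simp
  ultimately show ?thesis
    unfolding S'(1) by (subst card_glue) simp_all
qed

text \<open>The part of \<open>T\<close> in each copy is a forest there, though perhaps
  disconnected, and so extends to a spanning tree of that copy.\<close>

lemma tree_in_glued_tree:
  assumes T: "T \<in> spanning_trees (G (Suc n))"
  shows "\<exists>S\<in>glued_trees n. T \<subseteq> S"
proof -
  have sub: "T \<subseteq> edges (G (Suc n))" and ind: "indep (ends (G (Suc n))) T"
    using T unfolding spanning_trees_iff by blast+
  have "\<exists>S\<in>spanning_trees (G n). piece j T \<subseteq> S \<and> S \<subseteq> edges (G n)" for j
  proof (rule indep_extends_to_spanning_tree)
    show "piece j T \<subseteq> edges (G n)"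
      using sub by (auto simp: piece_def edges_approx_graph_Suc)
    show "indep (ends (G n)) (piece j T)"
      using ind by (simp add: ends_approx_graph indep_piece)
  qed (rule subset_refl verts_nonempty approx_graph_connected)+
  then obtain S where S: "\<And>j. S j \<in> spanning_trees (G n)" "\<And>j. piece j T \<subseteq> S j"
    by metis
  have "T \<subseteq> glue m (restrict S {1..m})"
  proof
    fix x assume "x \<in> T"
    then obtain j w e where "x = (j # w, e)" "j \<in> {1..m}" "(j # w, e) \<in> T"
      using sub by (auto simp: edges_approx_graph_Suc glue_def)
    then show "x \<in> glue m (restrict S {1..m})"
      using S(2)[of j] by (auto simp: piece_def)
  qed
  moreover have "restrict S {1..m} \<in> PiE {1..m} (\<lambda>_. spanning_trees (G n))"
    using S by auto
  ultimately show ?thesis by blast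
qed

text \<open>\<open>S\<close> connects each copy, hence joins the endpoints of every edge of the
  larger graph. It is therefore a connecting edge set, though it may contain cycles through several
  copies, and can be thinned to a spanning tree.\<close>

lemma tree_below_glued_tree:
  assumes "S \<in> glued_trees n"
  shows "\<exists>T\<in>spanning_trees (G (Suc n)). T \<subseteq> S"
proof -
  obtain S' where S': "S = glue m S'" "S' \<in> PiE {1..m} (\<lambda>_. spanning_trees (G n))"
    using assms by auto
  let ?d = "\<lambda>(w, e). foldr f w ` e"
  have d: "ends (G k) = ?d" for k by (simp add: ends_approx_graph)
  have copy: "(f j u, f j v) \<in> (link ?d S)\<^sup>*"
    if "j \<in> {1..m}" "u \<in> verts (G n)" "v \<in> verts (G n)" for j u v
  proof (rule rtrancl_link_piece)
    have "S' j = piece j S" using that S' by (auto simp: piece_def)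
    moreover have "S' j \<in> spanning_trees (G n)" using S' that by auto
    ultimately show "(u, v) \<in> (link ?d (piece j S))\<^sup>*"
      using that unfolding spanning_trees_iff d by auto
  qed
  have "link ?d (edges (G (Suc n))) \<subseteq> (link ?d S)\<^sup>*"
  proof clarify
    fix a b assume "(a, b) \<in> link ?d (edges (G (Suc n)))"
    then obtain j w e where e: "j \<in> {1..m}" "(w, e) \<in> edges (G n)" "?d (j # w, e) = {a, b}"
      by (auto simp: link_def edges_approx_graph_Suc glue_def)
    then obtain u v where uv: "u \<in> verts (G n)" "v \<in> verts (G n)" "?d (w, e) = {u, v}"
      using ends_verts[of "(w, e)" n] unfolding d by auto
    have "?d (j # w, e) = f j ` ?d (w, e)" by (simp add: foldr_Cons_image del: foldr.simps)
    then have "{a, b} = {f j u, f j v}" using e uv by simp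
    then show "(a, b) \<in> (link ?d S)\<^sup>*"
      using copy[OF e(1) uv(1,2)] sym_rtrancl_link by (auto simp: doubleton_eq_iff)
  qed
  then have "(link ?d (edges (G (Suc n))))\<^sup>* \<subseteq> (link ?d S)\<^sup>*"
    by (rule rtrancl_subset_rtrancl)
  then have "verts (G (Suc n)) \<times> verts (G (Suc n)) \<subseteq> (link (ends (G (Suc n))) S)\<^sup>*"
    using approx_graph_connected[of "Suc n"] unfolding d by blast
  then have "\<exists>T\<in>spanning_trees (G (Suc n)). {} \<subseteq> T \<and> T \<subseteq> S"
    by (intro indep_extends_to_spanning_tree[OF _ glued_trees_edges[OF assms] _ verts_nonempty])
      (simp_all add: indep_def)
  then show ?thesis by blast
qed

text \<open>Both sizes are determined by vertex counts: \<open>S\<close> has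
  \<open>m * (card (verts (G n)) - 1)\<close> edges and \<open>T\<close> has
  \<open>card (verts (G (Suc n))) - 1\<close>. The difference is at most \<open>c - (m - 1)\<close>
  as integers, hence at most \<open>c\<close> because \<open>m\<close> is positive.\<close>

lemma card_tree_sym_diff_glued_tree:
  assumes "T \<in> spanning_trees (G (Suc n))" and "S \<in> glued_trees n" and "T \<subseteq> S" and "0 < m"
    and v: "m * card (verts (G n)) \<le> card (verts (G (Suc n))) + c"
  shows "card (S - T) \<le> c"
proof -
  have "finite S" using glued_trees_edges[OF assms(2)] finite_edges finite_subset by blast
  then have "card (S - T) = m * (card (verts (G n)) - 1) - card T"
    using assms(3) card_glued_tree[OF assms(2)] by (simp add: card_Diff_subset finite_subset)
  also have "\<dots> \<le> c"
    using v card_spanning_tree[OF assms(1)] assms(4) by (simp add: diff_mult_distrib2)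
  finally show ?thesis .
qed

text \<open>Every tree is near a glued family and every glued family is near a tree, so the counting
  estimate applies in both directions. Here \<open>c\<close> bounds the number of vertices lost by
  identification.\<close>

lemma num_spanning_trees_Suc_bounds:
  assumes "0 < m" and "m * card (verts (G n)) \<le> card (verts (G (Suc n))) + c"
  shows "num_spanning_trees (G (Suc n)) \<le> num_spanning_trees (G n) ^ m * (card (edges (G (Suc n))) + 1) ^ c"
    and "num_spanning_trees (G n) ^ m \<le> num_spanning_trees (G (Suc n)) * (card (edges (G (Suc n))) + 1) ^ c"
proof -
  have fin: "finite (glued_trees n)"
    by (rule finite_imageI, rule finite_PiE) (simp_all add: finite_spanning_trees)
  have diff: "card (S - T) \<le> c"
    if "T \<in> spanning_trees (G (Suc n))" "S \<in> glued_trees n" "T \<subseteq> S" for T S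
    using card_tree_sym_diff_glued_tree[OF that assms] .
  have sub: "\<Union>(spanning_trees (G (Suc n))) \<subseteq> edges (G (Suc n))"
    "\<Union>(glued_trees n) \<subseteq> edges (G (Suc n))"
    by (rule Union_least, simp add: spanning_trees_def) (rule Union_least, rule glued_trees_edges)
  have "\<exists>S\<in>glued_trees n. card (sym_diff T S) \<le> c" if T: "T \<in> spanning_trees (G (Suc n))" for T
  proof -
    obtain S where S: "S \<in> glued_trees n" "T \<subseteq> S" using tree_in_glued_tree[OF T] by blast
    then have "sym_diff T S = S - T" by auto
    then show ?thesis using diff[OF T S] S(1) by metis
  qed
  from card_le_if_nearby[OF finite_edges fin sub this]
  show "num_spanning_trees (G (Suc n)) \<le> num_spanning_trees (G n) ^ m * (card (edges (G (Suc n))) + 1) ^ c"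
    by (simp only: card_glued_trees num_spanning_trees_def)
  have "\<exists>T\<in>spanning_trees (G (Suc n)). card (sym_diff S T) \<le> c" if S: "S \<in> glued_trees n" for S
  proof -
    obtain T where T: "T \<in> spanning_trees (G (Suc n))" "T \<subseteq> S"
      using tree_below_glued_tree[OF S] by blast
    then have "sym_diff S T = S - T" by auto
    then show ?thesis using diff[OF T(1) S T(2)] T(1) by metis
  qed
  from card_le_if_nearby[OF finite_edges finite_spanning_trees sub(2,1) this]
  show "num_spanning_trees (G n) ^ m \<le> num_spanning_trees (G (Suc n)) * (card (edges (G (Suc n))) + 1) ^ c"
    by (simp only: card_glued_trees num_spanning_trees_def)
qed

end

section \<open>Growth of the vertex sets\<close>

context fully_symmetric_self_similar_set
begin

lemma verts_subset: "verts (approx_graph m f F0 n) \<subseteq> K"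
proof (induction n)
  case 0
  show ?case using F0_subset by (simp add: approx_graph_def words_0)
next
  case (Suc n)
  then show ?case
    unfolding verts_approx_graph_Suc using self_similar by blast
qed

lemma fixed_point_unique:
  assumes "j \<in> {1..m}" and "f j x = x" and "f j y = y"
  shows "x = y"
proof (rule ccontr)
  assume "x \<noteq> y"
  obtain c where c: "c < 1" "c-lipschitz_on UNIV (f j)"
    using contraction_f[OF assms(1)] by blast
  have "dist (f j x) (f j y) \<le> c * dist x y"
    using lipschitz_onD[OF c(2)] by simp
  then show False using assms(2,3) c(1) \<open>x \<noteq> y\<close> by simp
qed

text \<open>If \<open>f j\<close> mapped \<open>F0\<close> into itself, each image would be a fixed
  point of \<open>f j\<close> by \<open>F0_fixed\<close>, and by injectivity so would each point of
  \<open>F0\<close>. A contraction cannot fix two points.\<close>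

lemma new_vertex:
  assumes "2 \<le> card F0" and "j \<in> {1..m}"
  shows "\<not> f j ` F0 \<subseteq> F0"
proof
  assume sub: "f j ` F0 \<subseteq> F0"
  have "f j v = v" if "v \<in> F0" for v
  proof -
    have "f j v \<in> F0 \<inter> f j ` K" using sub that F0_subset by auto
    then have "f j (f j v) = f j v" by (rule F0_fixed[OF assms(2)])
    then show ?thesis using inj_f[OF assms(2)] by (simp add: inj_eq)
  qed
  then have "\<forall>x\<in>F0. \<forall>y\<in>F0. x = y"
    using fixed_point_unique[OF assms(2)] by auto
  then have "card F0 \<le> Suc 0" by (simp only: card_le_Suc0_iff_eq[OF finite_F0])
  then show False using assms(1) by simp
qed

text \<open>No map would make \<open>K\<close> empty, and a single map would have all of
  \<open>F0\<close> as fixed points.\<close>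

lemma two_maps:
  assumes "2 \<le> card F0"
  shows "2 \<le> m"
proof (rule ccontr)
  assume "\<not> 2 \<le> m"
  have "K \<noteq> {}" using assms F0_subset by fastforce
  then have "m \<noteq> 0" using self_similar by auto
  then have m: "m = 1" using \<open>\<not> 2 \<le> m\<close> by simp
  then have "K = f 1 ` K" using self_similar by simp
  then have "f 1 v = v" if "v \<in> F0" for v
    using F0_fixed[of 1 v] F0_subset that m by auto
  then show False using new_vertex[OF assms, of 1] m by auto
qed

text \<open>Distinct copies meet only in images of \<open>F0\<close>, so images of inner vertices
  are never identified. Nor do they fall into \<open>F0\<close>: such an image would be the fixed
  point of \<open>f j\<close>, hence equal to its own preimage.\<close>

lemma card_inner_verts_Suc:
  "m * card (verts (approx_graph m f F0 n) - F0) \<le> card (verts (approx_graph m f F0 (Suc n)) - F0)"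
proof -
  interpret finite_multigraph "approx_graph m f F0 k" for k
    by (rule finite_multigraph_approx_graph[OF finite_F0])
  let ?I = "verts (approx_graph m f F0 n) - F0"
  have fin: "finite ?I" using finite_verts by simp
  have I: "?I \<subseteq> K" using verts_subset by blast
  have disj: "f j ` ?I \<inter> f k ` ?I = {}" if jk: "j \<in> {1..m}" "k \<in> {1..m}" "j \<noteq> k" for j k
  proof -
    have "f j ` ?I \<inter> f k ` ?I \<subseteq> f j ` F0"
      using finitely_ramified[OF jk] I by blast
    then show ?thesis using inj_f[OF jk(1)] by (auto simp: inj_def)
  qed
  have "card (\<Union>j\<in>{1..m}. f j ` ?I) = (\<Sum>j\<in>{1..m}. card (f j ` ?I))"
    using fin disj by (intro card_UN_disjoint) auto
  also have "\<dots> = (\<Sum>j\<in>{1..m}. card ?I)"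
  proof (rule sum.cong[OF refl])
    fix j assume "j \<in> {1..m}"
    then show "card (f j ` ?I) = card ?I"
      using inj_f inj_on_subset by (intro card_image) blast
  qed
  finally have "card (\<Union>j\<in>{1..m}. f j ` ?I) = m * card ?I" by simp
  moreover have "(\<Union>j\<in>{1..m}. f j ` ?I) \<subseteq> verts (approx_graph m f F0 (Suc n)) - F0"
  proof
    fix x assume "x \<in> (\<Union>j\<in>{1..m}. f j ` ?I)"
    then obtain j y where y: "j \<in> {1..m}" "y \<in> ?I" "x = f j y" by blast
    have "x \<notin> F0"
    proof
      assume "x \<in> F0"
      then have "f j x = x" using F0_fixed[OF y(1), of x] y I by blast
      then have "x = y" using y(3) inj_f[OF y(1)] by (simp add: inj_eq)
      then show False using \<open>x \<in> F0\<close> y(2) by simp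
    qed
    then show "x \<in> verts (approx_graph m f F0 (Suc n)) - F0"
      using y by (auto simp: verts_approx_graph_Suc)
  qed
  ultimately show ?thesis
    using card_mono finite_verts by (metis finite_Diff)
qed

text \<open>For the second bound, only the images of \<open>F0\<close> can be lost in the gluing, at
  most \<open>card F0\<close> vertices per copy.\<close>

lemma card_verts_Suc_bounds:
  "card (verts (approx_graph m f F0 (Suc n))) \<le> m * card (verts (approx_graph m f F0 n))"
  "m * card (verts (approx_graph m f F0 n)) \<le> card (verts (approx_graph m f F0 (Suc n))) + m * card F0"
proof -
  interpret finite_multigraph "approx_graph m f F0 k" for k
    by (rule finite_multigraph_approx_graph[OF finite_F0])
  let ?V = "\<lambda>n. verts (approx_graph m f F0 n)"
  have "card (?V (Suc n)) \<le> (\<Sum>j\<in>{1..m}. card (f j ` ?V n))"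
    unfolding verts_approx_graph_Suc by (rule card_UN_le) simp
  also have "\<dots> \<le> (\<Sum>j\<in>{1..m}. card (?V n))"
    using finite_verts by (intro sum_mono card_image_le)
  finally show "card (?V (Suc n)) \<le> m * card (?V n)" by simp
  have "card (?V n) \<le> card (?V n - F0) + card F0"
    using diff_card_le_card_Diff[OF finite_F0, of "?V n"] by linarith
  then have "m * card (?V n) \<le> m * card (?V n - F0) + m * card F0"
    by (metis add_mult_distrib2 mult_le_mono2)
  also have "\<dots> \<le> card (?V (Suc n) - F0) + m * card F0"
    using card_inner_verts_Suc by simp
  also have "\<dots> \<le> card (?V (Suc n)) + m * card F0"
    using finite_verts by (simp add: card_mono)
  finally show "m * card (?V n) \<le> card (?V (Suc n)) + m * card F0" .
qed

text \<open>The index is shifted because the graph of level 0 has no vertices outside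
  \<open>F0\<close>. Level 1 has at least one, and the number then grows at least by the factor
  \<open>m\<close>.\<close>

lemma card_verts_ge:
  assumes "2 \<le> card F0"
  shows "m ^ n \<le> card (verts (approx_graph m f F0 (Suc n)))"
proof -
  interpret finite_multigraph "approx_graph m f F0 k" for k
    by (rule finite_multigraph_approx_graph[OF finite_F0])
  have "m ^ n \<le> card (verts (approx_graph m f F0 (Suc n)) - F0)"
  proof (induction n)
    case 0
    have "1 \<in> {1..m}" using two_maps[OF assms] by simp
    moreover from this have "f 1 ` F0 \<subseteq> verts (approx_graph m f F0 (Suc 0))"
      unfolding verts_approx_graph_Suc by (auto simp: approx_graph_def words_0)
    ultimately have "verts (approx_graph m f F0 (Suc 0)) - F0 \<noteq> {}"
      using new_vertex[OF assms, of 1] by blast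
    then show ?case using finite_verts by (simp add: Suc_le_eq card_gt_0_iff)
  next
    case (Suc n)
    then show ?case
      using card_inner_verts_Suc[of "Suc n"] by (metis mult_le_mono2 order_trans power_Suc)
  qed
  then show ?thesis
    using finite_verts by (meson Diff_subset card_mono order_trans)
qed

end

section \<open>Convergence\<close>

text \<open>The increments of \<open>x n / b ^ n\<close> are dominated by a constant times
  \<open>(n + 1) / b ^ n\<close>, the terms of the differentiated geometric series, so the
  telescoping series converges.\<close>

lemma convergent_div_power:
  fixes x :: "nat \<Rightarrow> real"
  assumes "1 < b" and "0 \<le> C" and le: "\<And>n. \<bar>x (Suc n) - b * x n\<bar> \<le> C * real (Suc n)"
  shows "convergent (\<lambda>n. x n / b ^ n)"
proof -
  have "norm (x (Suc n) / b ^ Suc n - x n / b ^ n) \<le> C * (real (Suc n) * (1 / b) ^ n)" for n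
  proof -
    have "x (Suc n) / b ^ Suc n - x n / b ^ n = (x (Suc n) - b * x n) / b ^ Suc n"
      using assms(1) by (simp add: field_simps)
    then have "norm (x (Suc n) / b ^ Suc n - x n / b ^ n) = \<bar>x (Suc n) - b * x n\<bar> / b ^ Suc n"
      using assms(1) by (simp add: abs_mult)
    also have "\<dots> \<le> C * real (Suc n) / b ^ Suc n"
      using le assms(1) by (intro divide_right_mono) auto
    \<comment> \<open>One factor \<open>1 / b\<close> is given up to match the terms of
      \<open>geometric_deriv_sums\<close>.\<close>
    also have "\<dots> \<le> C * real (Suc n) / b ^ n"
      using assms by (intro divide_left_mono) (auto simp: power_increasing)
    finally show ?thesis by (simp add: power_divide)
  qed
  moreover have "summable (\<lambda>n. C * (real (Suc n) * (1 / b) ^ n))"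
    using geometric_deriv_sums[of "1 / b"] assms(1)
    by (intro summable_mult) (simp add: sums_iff)
  ultimately have "summable (\<lambda>n. x (Suc n) / b ^ Suc n - x n / b ^ n)"
    by (rule summable_comparison_test'[rotated])
  then have "convergent (\<lambda>n. x n / b ^ n - x 0)"
    unfolding summable_iff_convergent by (simp only: sum_lessThan_telescope[of "\<lambda>n. x n / b ^ n"] power_0 div_by_1)
  then show ?thesis
    by (simp add: convergent_diff_const_right_iff)
qed

section \<open>Existence of the asymptotic complexity constant\<close>

theorem theorem4p2:
  fixes K :: "'a::complete_space set"
    and m :: nat
    and f :: "nat \<Rightarrow> 'a \<Rightarrow> 'a"
    and F0 :: "'a set"
  assumes "fully_symmetric_self_similar_set K m f F0"
    and "\<And>n. connected_multigraph (approx_graph m f F0 n)"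
    and "\<And>n. loopless (approx_graph m f F0 n)"
  shows "convergent (\<lambda>n. ln (real (num_spanning_trees (approx_graph m f F0 n))) /
                         real (card (verts (approx_graph m f F0 n))))"
proof -
  interpret fully_symmetric_self_similar_set K m f F0 by fact
  define \<tau> where "\<tau> n = num_spanning_trees (approx_graph m f F0 n)" for n
  define v where "v n = card (verts (approx_graph m f F0 n))" for n
  have \<tau>_pos: "0 < \<tau> n" for n
    unfolding \<tau>_def by (rule num_spanning_trees_pos[OF finite_F0 assms(2)])
  show ?thesis
  proof (cases "2 \<le> card F0")
    case False
    have "card e \<noteq> 2" if "e \<subseteq> F0" for e
      using card_mono[OF finite_F0 that] False by linarith
    then have "complete_graph_edges F0 = {}"
      unfolding complete_graph_edges_def by blast
    then have "spanning_trees (approx_graph m f F0 n) \<subseteq> {{}}" for n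
      by (auto simp: spanning_trees_def approx_graph_def)
    then have "\<tau> n \<le> card {{} :: (nat list \<times> 'a set) set}" for n
      unfolding \<tau>_def num_spanning_trees_def by (intro card_mono) simp_all
    then have "\<tau> n = 1" for n
      using \<tau>_pos[of n] by (simp add: le_antisym Suc_leI)
    then show ?thesis by (simp add: \<tau>_def convergent_const)
  next
    case True
    have m: "2 \<le> m" using two_maps[OF True] .
    define c where "c = m * card F0"
    define q where "q = card (complete_graph_edges F0)"
    \<comment> \<open>There are \<open>m ^ Suc n * q\<close> edges on level \<open>n + 1\<close>.
      Since \<open>m ^ Suc n\<close> is at least 1, the added 1 is absorbed into
      \<open>m ^ Suc n * (q + 1)\<close>, whose logarithm grows linearly in
      \<open>n\<close>.\<close>
    define C where "C = real c * (ln (real m) + ln (real q + 1))"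
    have v_bounds: "v (Suc n) \<le> m * v n" "m * v n \<le> v (Suc n) + c" for n
      unfolding v_def c_def by (rule card_verts_Suc_bounds)+
    have E: "real c * ln (real (card (edges (approx_graph m f F0 (Suc n))) + 1)) \<le> C * real (Suc n)" for n
    proof -
      have "card (edges (approx_graph m f F0 (Suc n))) = m ^ Suc n * q"
        by (simp add: approx_graph_def card_cartesian_product card_words q_def)
      moreover have "1 \<le> real m ^ Suc n" using m by (intro one_le_power) simp
      ultimately have "real (card (edges (approx_graph m f F0 (Suc n))) + 1) \<le> real m ^ Suc n * (real q + 1)"
        by (simp add: algebra_simps)
      then have "ln (real (card (edges (approx_graph m f F0 (Suc n))) + 1)) \<le> ln (real m ^ Suc n * (real q + 1))"
        by (subst ln_le_cancel_iff) (use m in auto)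
      also have "\<dots> = real (Suc n) * ln (real m) + ln (real q + 1)"
        using m by (simp add: ln_mult ln_realpow del: power_Suc)
      also have "\<dots> \<le> (ln (real m) + ln (real q + 1)) * real (Suc n)"
        by (simp add: algebra_simps)
      finally show ?thesis
        unfolding C_def by (simp add: mult.assoc mult_left_mono)
    qed
    have "\<bar>ln (real (\<tau> (Suc n))) - real m * ln (real (\<tau> n))\<bar> \<le> C * real (Suc n)" for n
    proof -
      let ?N = "card (edges (approx_graph m f F0 (Suc n))) + 1"
      have "0 < m" using m by simp
      note b = num_spanning_trees_Suc_bounds[OF finite_F0 assms(2) this v_bounds(2)[of n, unfolded v_def],
          folded \<tau>_def]
      have ln_le: "ln (real x) \<le> ln (real y) + real c * ln (real ?N)"
        if "x \<le> y * ?N ^ c" "0 < x" "0 < y" for x y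
      proof -
        have "real x \<le> real y * real ?N ^ c"
          using that(1) by (metis of_nat_le_iff of_nat_mult of_nat_power)
        then have "ln (real x) \<le> ln (real y * real ?N ^ c)"
          using that by (subst ln_le_cancel_iff) auto
        also have "\<dots> = ln (real y) + real c * ln (real ?N)"
          using that by (simp add: ln_mult ln_realpow)
        finally show ?thesis .
      qed
      have "ln (real (\<tau> (Suc n))) \<le> real m * ln (real (\<tau> n)) + real c * ln (real ?N)"
        "real m * ln (real (\<tau> n)) \<le> ln (real (\<tau> (Suc n))) + real c * ln (real ?N)"
        using ln_le[OF b(1)] ln_le[OF b(2)] \<tau>_pos by (simp_all add: ln_realpow)
      then show ?thesis using E[of n] by linarith
    qed
    moreover have "0 \<le> C" using m by (simp add: C_def)
    ultimately have "convergent (\<lambda>n. ln (real (\<tau> n)) / real m ^ n)"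
      using m by (intro convergent_div_power) auto
    then obtain a where a: "(\<lambda>n. ln (real (\<tau> n)) / real m ^ n) \<longlonglongrightarrow> a"
      by (auto simp: convergent_def)
    \<comment> \<open>The error for the vertex counts is bounded by \<open>c\<close>; it is weakened
      to a linear bound so that the same convergence lemma applies.\<close>
    have "\<bar>real (v (Suc n)) - real m * real (v n)\<bar> \<le> real c * real (Suc n)" for n
    proof -
      have "real (v (Suc n)) \<le> real m * real (v n)" "real m * real (v n) \<le> real (v (Suc n)) + real c"
        using v_bounds[of n] by (metis of_nat_le_iff of_nat_mult of_nat_add)+
      moreover have "real c \<le> real c * real (Suc n)" by (simp add: algebra_simps)
      ultimately show ?thesis by linarith
    qed
    then have "convergent (\<lambda>n. real (v n) / real m ^ n)"
      using m by (intro convergent_div_power[where C = "real c"]) auto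
    then obtain l where l: "(\<lambda>n. real (v n) / real m ^ n) \<longlonglongrightarrow> l"
      by (auto simp: convergent_def)
    \<comment> \<open>The loss of a factor \<open>m\<close> reflects the index shift in
      \<open>card_verts_ge\<close>. Any positive lower bound keeps the limit \<open>l\<close> away
      from 0.\<close>
    have "1 / real m \<le> real (v n) / real m ^ n" if n: "1 \<le> n" for n
    proof -
      obtain k where k: "n = Suc k" using n by (cases n) auto
      have "real m ^ k \<le> real (v n)"
        using card_verts_ge[OF True, of k] unfolding v_def k by (metis of_nat_le_iff of_nat_power)
      then show ?thesis using m k by (simp add: field_simps)
    qed
    then have "1 / real m \<le> l"
      by (intro LIMSEQ_le_const[OF l]) auto
    then have "l \<noteq> 0" using m by (auto simp: field_simps)
    \<comment> \<open>The common factor \<open>m ^ n\<close> cancels in the quotient, so the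
      complexity constant is \<open>a / l\<close>.\<close>
    have "(\<lambda>n. (ln (real (\<tau> n)) / real m ^ n) / (real (v n) / real m ^ n)) \<longlonglongrightarrow> a / l"
      by (rule tendsto_divide[OF a l \<open>l \<noteq> 0\<close>])
    then show ?thesis
      using m by (auto simp: convergent_def \<tau>_def v_def)
  qed
qed

end
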